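(* Let $p > 2$ be a prime and let $f(X) = \alpha X^2 + \beta X + \gamma$ be a quadratic polynomial over $\mathbb{F}_p$ with $\alpha \neq 0$. Let $$\mathcal{S} = \{(x,y) \in \mathbb{F}_p^2 : y < f(x)\}.$$ Then for any $d \in \mathbb{F}_p^* = \mathbb{F}_p\setminus\{0\}$ and any $b \in \mathbb{F}_p$, $$\mathrm{pr}_{\mathcal{S},d}(b) = \mathrm{pr}_{\mathcal{S},1}\left( b - \left(\beta-\frac{d+1}{2}\right)\frac{d-1}{2\alpha} \right).$$ Moreover, for every $d \in \mathbb{F}_p^*$, the image of $\mathrm{pr}_{\mathcal{S},d}$ is an interval of integers whose length lies between $\frac{\sqrt p}{2 \pi}$ and $\sqrt p \ln(p)$.
   Context: Every element of $\mathbb{F}_p$ corresponds to a unique integer in $\{0,1,\dots,p-1\}$; write $\nu(x)$ for the integer corresponding to $x \in \mathbb{F}_p$. The order relation $<$ on $\mathbb{F}_p$ is the one induced by this: $x<y$ if and only if $\nu(x)<\nu(y)$ in $\mathbb{Z}$. For a set $\mathcal{S} \subseteq \mathbb{F}_p^2$ and $d \in \mathbb{F}_p$, the projection function $\mathrm{pr}_{\mathcal{S},d} : \mathbb{F}_p \to \mathbb{N}$ maps $b$ to the number of points of $\mathcal{S}$ on the line $Y = dX + b$, i.e. $\mathrm{pr}_{\mathcal{S},d}(b) = |\{x \in \mathbb{F}_p : (x, dx+b) \in \mathcal{S}\}|$. All arithmetic in the argument of the projection function is in $\mathbb{F}_p$. An interval of integers is a set of the form $\{m, m+1, \dots, M\}$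 with $m \le M$ integers; its length is $M-m$. *)

theory Defs
  imports Complex_Main "Berlekamp_Zassenhaus.Finite_Field"
begin

text \<open>
  For a type \<open>'p\<close> of prime cardinality, \<open>'p mod_ring\<close> is the prime field with \<open>p = CARD('p)\<close>
  elements, and \<open>to_int_mod_ring\<close> maps each element to its representative in
  \<open>{0, ..., p - 1}\<close>. The order below is the one of these representatives; it is not
  compatible with the field operations.
\<close>

instantiation mod_ring :: (finite) linorder
begin

definition less_eq_mod_ring :: "'a mod_ring \<Rightarrow> 'a mod_ring \<Rightarrow> bool" where
  "x \<le> y \<longleftrightarrow> to_int_mod_ring x \<le> to_int_mod_ring y"

definition less_mod_ring :: "'a mod_ring \<Rightarrow> 'a mod_ring \<Rightarrow> bool" where
  "x < y \<longleftrightarrow> to_int_mod_ring x < to_int_mod_ring y"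

instance
  by standard (auto simp: less_eq_mod_ring_def less_mod_ring_def)

end

definition proj :: "('p::prime_card mod_ring \<times> 'p mod_ring) set \<Rightarrow> 'p mod_ring \<Rightarrow> 'p mod_ring \<Rightarrow> nat" where
  "proj S d b = card {x. (x, d * x + b) \<in> S}"

end

theory Submission
  imports Defs "HOL-Analysis.Convex"
begin

text \<open>
  The comparison \<open>u < v\<close> is the borrow in the subtraction \<open>u - v\<close> of representatives. Summing over a
  line of nonzero slope, \<open>p\<close> times the projection at \<open>b\<close> is, up to a constant independent of \<open>d\<close> and
  \<open>b\<close>, the sum over \<open>x\<close> of the representatives of \<open>d x + b - f x\<close>. A translation of \<open>x\<close> normalises
  the linear coefficient, which gives the first claim. Moreover the step from \<open>b - 1\<close> to \<open>b\<close> is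
  \<open>1\<close> minus the number of roots of \<open>f x - d x = b\<close>, hence at most \<open>1\<close> in absolute value, so the image
  is an interval. The Fourier coefficients of these steps at nonzero frequencies are quadratic Gauss
  sums of modulus \<open>sqrt p\<close>, and they are the coefficients of the projection function multiplied by
  \<open>1 - add_char a\<close>. The coefficient at frequency \<open>1\<close> bounds the oscillation from below; Fourier
  inversion, as in the Polya-Vinogradov inequality, bounds it from above.
\<close>

section \<open>Elementary estimates: the sine, the logarithm and a sum of cosecants\<close>

text \<open>By concavity on \<open>{0..pi/2}\<close>, the graph of \<open>sin\<close> lies above its
  chord from the origin to \<open>(pi/2, 1)\<close>.\<close>

lemma jordan_sin_ineq:
  fixes x :: real
  assumes "0 \<le> x" "x \<le> pi / 2"
  shows "2 * x / pi \<le> sin x"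
proof -
  have "concave_on {0..pi/2} (sin :: real \<Rightarrow> real)"
    by (rule f''_le0_imp_concave[where f' = cos and f'' = "\<lambda>x. - sin x"])
       (auto intro!: derivative_eq_intros sin_ge_zero)
  then have "sin ((1 - 2*x/pi) *\<^sub>R 0 + (2*x/pi) *\<^sub>R (pi/2)) \<ge> (1 - 2*x/pi) * sin 0 + (2*x/pi) * sin (pi/2)"
    using assms by (intro concave_onD) (auto simp: field_simps)
  then show ?thesis by simp
qed

text \<open>The difference of the two sides vanishes at 0 and has derivative
  \<open>2 * t^2 / ((1 + t) * (1 - t))\<close>.\<close>

lemma ln_ratio_ge:
  fixes y :: real
  assumes "0 \<le> y" "y < 1"
  shows "2 * y \<le> ln (1 + y) - ln (1 - y)"
proof -
  let ?g = "\<lambda>y::real. ln (1 + y) - ln (1 - y) - 2 * y"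
  have "?g 0 \<le> ?g y"
  proof (rule DERIV_nonneg_imp_nondecreasing[OF assms(1)])
    fix t assume t: "0 \<le> t" "t \<le> y"
    have d: "(?g has_real_derivative (1 / (1 + t) + 1 / (1 - t) - 2)) (at t)"
      using t assms by (auto intro!: derivative_eq_intros)
    have "1 / (1 + t) + 1 / (1 - t) - 2 = 2 * t^2 / ((1 + t) * (1 - t))"
    proof -
      have "1 + t \<noteq> 0" "1 - t \<noteq> 0" using t assms by auto
      then show ?thesis by (simp add: divide_simps) (simp add: power2_eq_square algebra_simps)
    qed
    also have "\<dots> \<ge> 0" using t assms by simp
    finally show "\<exists>z. (?g has_real_derivative z) (at t) \<and> 0 \<le> z" using d by blast
  qed
  then show ?thesis by simp
qed

text \<open>Each \<open>1 / k\<close> is at most \<open>ln (2*k + 1) - ln (2*k - 1)\<close>, and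
  these differences telescope. For \<open>p = 2*m + 1\<close> the bound is exactly
  \<open>ln p\<close>, so that no constant is lost in the final upper bound.\<close>

lemma sum_inverse_le_ln: "(\<Sum>k=1..m. 1 / real k) \<le> ln (2 * real m + 1)"
proof (induction m)
  case (Suc m)
  define y where "y = 1 / (2 * real m + 2)"
  have y: "0 \<le> y" "y < 1" by (auto simp: y_def)
  have "1 + y = (2 * real m + 3) / (2 * real m + 2)" "1 - y = (2 * real m + 1) / (2 * real m + 2)"
    by (auto simp: y_def field_simps)
  then have "ln (1 + y) - ln (1 - y) = ln (2 * real m + 3) - ln (2 * real m + 1)"
    by (simp add: ln_div)
  moreover have "2 * y = 1 / real (Suc m)" by (simp add: y_def divide_simps)
  ultimately have "1 / real (Suc m) \<le> ln (2 * real m + 3) - ln (2 * real m + 1)"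
    using ln_ratio_ge[OF y] by simp
  moreover have "(\<Sum>k=1..Suc m. 1 / real k) = (\<Sum>k=1..m. 1 / real k) + 1 / real (Suc m)"
    by simp
  ultimately have "(\<Sum>k=1..Suc m. 1 / real k) \<le> ln (2 * real m + 3)"
    using Suc by linarith
  also have "2 * real m + 3 = 2 * real (Suc m) + 1" by simp
  finally show ?case .
qed simp

text \<open>The symmetry \<open>sin (pi - t) = sin t\<close> folds the sum onto
  \<open>k \<le> m\<close>. There the chord bound for the sine leaves a harmonic sum.\<close>

lemma sum_inverse_sin_le:
  "(\<Sum>k=1..2*m. 1 / sin (pi * real k / real (2*m+1))) \<le> real (2*m+1) * ln (real (2*m+1))"
proof -
  let ?n = "real (2*m+1)"
  let ?g = "\<lambda>k. 1 / sin (pi * real k / ?n)"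
  have "(\<Sum>k=1..2*m. ?g k) = (\<Sum>k=1..m. ?g k) + (\<Sum>k=m+1..2*m. ?g k)"
  proof -
    have "{1..2*m} = {1..m} \<union> {m+1..2*m}" by auto
    then show ?thesis by (simp only:) (rule sum.union_disjoint; auto)
  qed
  also have "(\<Sum>k=m+1..2*m. ?g k) = (\<Sum>k=1..m. ?g k)"
  proof (rule sum.reindex_bij_witness[of _ "\<lambda>k. 2*m+1-k" "\<lambda>k. 2*m+1-k"])
    fix k assume k: "k \<in> {m+1..2*m}"
    then have "real (2*m+1-k) = ?n - real k" by (subst of_nat_diff) auto
    then have "pi * real (2*m+1-k) / ?n = pi - pi * real k / ?n"
      by (simp add: field_simps)
    then show "?g (2*m+1-k) = ?g k" by simp
  qed auto
  also have "(\<Sum>k=1..m. ?g k) + (\<Sum>k=1..m. ?g k) = 2 * (\<Sum>k=1..m. ?g k)" by simp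
  also have "(\<Sum>k=1..m. ?g k) \<le> (\<Sum>k=1..m. (?n / 2) * (1 / real k))"
  proof (rule sum_mono)
    fix k assume k: "k \<in> {1..m}"
    \<comment> \<open>Since \<open>2 * k \<le> 2 * m + 1\<close>, the angle is at most
      \<open>pi / 2\<close>, where the chord bound applies.\<close>
    have "pi * (2 * real k) \<le> pi * ?n"
      using k by (intro mult_left_mono) auto
    then have "2 * (pi * real k / ?n) / pi \<le> sin (pi * real k / ?n)"
      by (intro jordan_sin_ineq) (auto simp: field_simps)
    then have "2 * real k / ?n \<le> sin (pi * real k / ?n)" by simp
    then have "?g k \<le> 1 / (2 * real k / ?n)"
      using k by (intro divide_left_mono mult_pos_pos) (auto intro: less_le_trans[rotated])
    then show "?g k \<le> (?n / 2) * (1 / real k)" by simp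
  qed
  also have "\<dots> = (?n / 2) * (\<Sum>k=1..m. 1 / real k)" by (simp only: sum_distrib_left)
  also have "\<dots> \<le> (?n / 2) * ln ?n"
    using sum_inverse_le_ln[of m] by (intro mult_left_mono) (auto simp: add.commute)
  finally show ?thesis by (simp add: algebra_simps)
qed

section \<open>Additive characters and quadratic Gauss sums\<close>

definition add_char :: "'p::prime_card mod_ring \<Rightarrow> complex" where
  "add_char u = cis (2 * pi * real_of_int (to_int_mod_ring u) / real CARD('p))"

lemma to_int_mod_ring_bounds:
  fixes u :: "'p::prime_card mod_ring"
  shows "0 \<le> to_int_mod_ring u" "to_int_mod_ring u < int CARD('p)"
  using range_to_int_mod_ring[where 'a = 'p] by auto

lemma to_int_mod_ring_pos:
  fixes u :: "'p::prime_card mod_ring"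
  shows "u \<noteq> 0 \<Longrightarrow> 0 < to_int_mod_ring u"
  using to_int_mod_ring_bounds(1)[of u] to_int_mod_ring_hom.hom_0_iff[of u] by linarith

lemma add_char_0 [simp]: "add_char 0 = 1"
  by (simp add: add_char_def)

lemma norm_add_char [simp]: "norm (add_char u) = 1"
  by (simp add: add_char_def)

lemma add_char_neq_0 [simp]: "add_char u \<noteq> 0"
  by (simp add: add_char_def)

text \<open>Reducing the sum of representatives modulo \<open>p\<close> changes the angle by a
  multiple of \<open>2 * pi\<close>.\<close>

lemma add_char_add:
  fixes u v :: "'p::prime_card mod_ring"
  shows "add_char (u + v) = add_char u * add_char v"
proof -
  define p where "p = CARD('p)"
  define s where "s = to_int_mod_ring u + to_int_mod_ring v"
  have p: "real p > 0" by (simp add: p_def)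
  have "to_int_mod_ring (u + v) = s - int p * (s div int p)"
    unfolding to_int_mod_ring_add s_def p_def by (simp add: minus_mult_div_eq_mod)
  then have "real_of_int (to_int_mod_ring (u + v)) = real_of_int s - real p * real_of_int (s div int p)"
    by (simp only: of_int_diff of_int_mult of_int_of_nat_eq)
  then have "2 * pi * real_of_int (to_int_mod_ring (u + v)) / real p
    = 2 * pi * real_of_int s / real p - 2 * pi * real_of_int (s div int p)"
    using p by (simp only:) (simp add: field_simps)
  then have "add_char (u + v) = cis (2 * pi * real_of_int s / real p - 2 * pi * real_of_int (s div int p))"
    by (simp only: add_char_def p_def[symmetric])
  also have "\<dots> = cis (2 * pi * real_of_int s / real p) / cis (2 * pi * real_of_int (s div int p))"
    by (rule cis_divide[symmetric])
  also have "\<dots> = cis (2 * pi * real_of_int s / real p)"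
    by (subst cis_multiple_2pi) auto
  also have "\<dots> = add_char u * add_char v"
    by (simp add: add_char_def p_def[symmetric] cis_mult s_def distrib_left add_divide_distrib)
  finally show ?thesis .
qed

lemma add_char_minus: "add_char (- u) = cnj (add_char u)"
proof -
  have "add_char u * add_char (- u) = 1" by (simp flip: add_char_add)
  moreover have "add_char u * cnj (add_char u) = 1"
    by (simp add: complex_norm_square[symmetric])
  ultimately show ?thesis by (metis add_char_neq_0 mult_left_cancel)
qed

text \<open>This is the half-angle formula for the chord from 1 to \<open>cis (2 * t)\<close>. No
  absolute value is needed around the sine, because \<open>t\<close> lies between 0 and
  \<open>pi\<close>.\<close>

lemma norm_one_minus_add_char:
  fixes u :: "'p::prime_card mod_ring"
  shows "norm (1 - add_char u) = 2 * sin (pi * real_of_int (to_int_mod_ring u) / real CARD('p))"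
proof -
  define t where "t = pi * real_of_int (to_int_mod_ring u) / real CARD('p)"
  have "0 \<le> t" "t \<le> pi"
    using to_int_mod_ring_bounds[of u] by (auto simp: t_def field_simps)
  then have s: "sin t \<ge> 0" by (rule sin_ge_zero)
  have "add_char u = cis (2 * t)" by (simp add: add_char_def t_def mult_ac)
  then have "(norm (1 - add_char u))^2 = (1 - cos (2*t))^2 + (sin (2*t))^2"
    by (simp add: cmod_power2)
  also have "\<dots> = (2 * sin t)^2"
    using sin_cos_squared_add[of "2*t"] cos_double_sin[of t]
    by (simp add: power2_eq_square algebra_simps)
  finally show ?thesis using s unfolding t_def[symmetric]
    by (intro power2_eq_imp_eq[of _ "2 * sin t"]) auto
qed

lemma norm_one_minus_add_char_pos:
  fixes u :: "'p::prime_card mod_ring"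
  assumes "u \<noteq> 0"
  shows "0 < norm (1 - add_char u)"
  using to_int_mod_ring_bounds[of u] to_int_mod_ring_pos[OF assms]
  by (auto simp: norm_one_minus_add_char intro!: sin_gt_zero divide_pos_pos) (simp add: field_simps)

lemma sum_shift_mod_ring:
  fixes g :: "'p::prime_card mod_ring \<Rightarrow> 'b::comm_monoid_add"
  shows "(\<Sum>u\<in>UNIV. g (u + c)) = (\<Sum>u\<in>UNIV. g u)"
  by (rule sum.reindex_bij_witness[of _ "\<lambda>u. u - c" "\<lambda>u. u + c"]) auto

text \<open>Translating \<open>u\<close> by 1 multiplies the sum by \<open>add_char a\<close>, which
  differs from 1.\<close>

lemma sum_add_char:
  fixes a :: "'p::prime_card mod_ring"
  assumes "a \<noteq> 0"
  shows "(\<Sum>u\<in>UNIV. add_char (a * u)) = 0"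
proof -
  let ?S = "\<Sum>u\<in>UNIV. add_char (a * u)"
  have "?S = (\<Sum>u\<in>UNIV. add_char (a * (u + 1)))"
    using sum_shift_mod_ring[of "\<lambda>u. add_char (a * u)" 1] by simp
  also have "\<dots> = add_char a * ?S"
    by (simp add: distrib_left add_char_add sum_distrib_left mult.commute)
  finally have "(1 - add_char a) * ?S = 0" by (simp add: algebra_simps)
  then show ?thesis using norm_one_minus_add_char_pos[OF assms] by auto
qed

lemma two_neq_0_mod_ring:
  assumes "CARD('p::prime_card) > 2"
  shows "(2 :: 'p mod_ring) \<noteq> 0"
proof
  assume "(2 :: 'p mod_ring) = 0"
  then have "of_nat 2 = (0 :: 'p mod_ring)" by simp
  then have "CARD('p) dvd 2" by (rule of_nat_0_mod_ring_dvd)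
  then show False using assms by (auto dest: dvd_imp_le)
qed

text \<open>Expand the squared modulus as a double sum and substitute \<open>x = h + y\<close>. The
  terms in \<open>y^2\<close> cancel, so the sum over \<open>y\<close> is a character sum with
  frequency \<open>2 * a * h\<close>; in odd characteristic it vanishes unless \<open>h = 0\<close>,
  which contributes \<open>p\<close>.\<close>

lemma norm_quadratic_gauss_sum:
  fixes a b c :: "'p::prime_card mod_ring"
  assumes "CARD('p) > 2" "a \<noteq> 0"
  shows "norm (\<Sum>x\<in>UNIV. add_char (a * x^2 + b * x + c)) = sqrt (real CARD('p))"
proof -
  define q where "q = (\<lambda>x. a * x^2 + b * x + c)"
  let ?G = "\<Sum>x\<in>UNIV. add_char (q x)"
  have "?G * cnj ?G = (\<Sum>y\<in>UNIV. \<Sum>x\<in>UNIV. add_char (q x) * cnj (add_char (q y)))"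
    by (simp add: cnj_sum sum_distrib_left sum_distrib_right)
  also have "\<dots> = (\<Sum>y\<in>UNIV. \<Sum>x\<in>UNIV. add_char (q x - q y))"
    by (simp flip: add_char_minus add_char_add)
  also have "\<dots> = (\<Sum>y\<in>UNIV. \<Sum>h\<in>UNIV. add_char (q (h + y) - q y))"
    by (intro sum.cong refl sum_shift_mod_ring[symmetric])
  also have "\<dots> = (\<Sum>y\<in>UNIV. \<Sum>h\<in>UNIV. add_char (a * h^2 + b * h) * add_char ((2 * a * h) * y))"
  proof (intro sum.cong refl)
    fix y h
    have "q (h + y) - q y = (a * h^2 + b * h) + (2 * a * h) * y"
      by (simp add: q_def power2_eq_square algebra_simps)
    then show "add_char (q (h + y) - q y) = add_char (a * h^2 + b * h) * add_char ((2 * a * h) * y)"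
      by (simp only: add_char_add)
  qed
  also have "\<dots> = (\<Sum>h\<in>UNIV. add_char (a * h^2 + b * h) * (\<Sum>y\<in>UNIV. add_char ((2 * a * h) * y)))"
    by (subst sum.swap) (simp only: sum_distrib_left)
  also have "\<dots> = (\<Sum>h\<in>(UNIV :: 'p mod_ring set). if h = 0 then of_nat CARD('p) else 0)"
  proof (intro sum.cong refl)
    fix h :: "'p mod_ring"
    show "add_char (a * h^2 + b * h) * (\<Sum>y\<in>UNIV. add_char ((2 * a * h) * y))
      = (if h = 0 then of_nat CARD('p) else 0)"
      using assms two_neq_0_mod_ring[where 'p = 'p] sum_add_char[of "2 * a * h"]
      by (cases "h = 0") auto
  qed
  also have "\<dots> = of_nat CARD('p)" by simp
  finally have "(norm ?G)^2 = real CARD('p)"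
    by (metis complex_norm_square of_real_eq_iff of_real_of_nat_eq)
  then show ?thesis by (simp add: q_def real_sqrt_unique)
qed

section \<open>Fourier coefficients and the oscillation of a function\<close>

lemma fourier_backward_difference:
  fixes F :: "'p::prime_card mod_ring \<Rightarrow> complex"
  shows "(\<Sum>c\<in>UNIV. (F c - F (c - 1)) * add_char (a * c))
    = (1 - add_char a) * (\<Sum>c\<in>UNIV. F c * add_char (a * c))"
proof -
  have "(\<Sum>c\<in>UNIV. F (c - 1) * add_char (a * c)) = (\<Sum>c\<in>UNIV. F c * add_char (a * (c + 1)))"
    using sum_shift_mod_ring[of "\<lambda>c. F (c - 1) * add_char (a * c)" 1] by simp
  also have "\<dots> = add_char a * (\<Sum>c\<in>UNIV. F c * add_char (a * c))"
    by (simp add: distrib_left add_char_add sum_distrib_left mult_ac)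
  finally show ?thesis
    by (simp add: left_diff_distrib sum_subtractf)
qed

text \<open>After exchanging the sums, orthogonality of characters leaves only the term
  \<open>c = b\<close>.\<close>

lemma fourier_inversion:
  fixes F :: "'p::prime_card mod_ring \<Rightarrow> complex"
  shows "of_nat CARD('p) * F b
    = (\<Sum>a\<in>UNIV. add_char (- (a * b)) * (\<Sum>c\<in>UNIV. F c * add_char (a * c)))"
proof -
  have "(\<Sum>a\<in>UNIV. add_char (- (a * b)) * (\<Sum>c\<in>UNIV. F c * add_char (a * c)))
    = (\<Sum>a\<in>UNIV. \<Sum>c\<in>UNIV. F c * add_char ((c - b) * a))"
  proof (intro sum.cong refl)
    fix a
    have "add_char (- (a * b)) * add_char (a * c) = add_char ((c - b) * a)" for c
      by (simp flip: add_char_add add: algebra_simps)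
    then show "add_char (- (a * b)) * (\<Sum>c\<in>UNIV. F c * add_char (a * c))
      = (\<Sum>c\<in>UNIV. F c * add_char ((c - b) * a))"
      by (simp add: sum_distrib_left mult.left_commute)
  qed
  also have "\<dots> = (\<Sum>c\<in>UNIV. F c * (\<Sum>a\<in>UNIV. add_char ((c - b) * a)))"
    by (subst sum.swap) (simp only: sum_distrib_left)
  also have "\<dots> = (\<Sum>c\<in>UNIV. if c = b then of_nat CARD('p) * F b else 0)"
  proof (intro sum.cong refl)
    fix c
    show "F c * (\<Sum>a\<in>UNIV. add_char ((c - b) * a)) = (if c = b then of_nat CARD('p) * F b else 0)"
      using sum_add_char[of "c - b"] by (cases "c = b") auto
  qed
  also have "\<dots> = of_nat CARD('p) * F b" by simp
  finally show ?thesis by simp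
qed

text \<open>Indexed by representatives, the summands are the cosecants
  \<open>1 / sin (pi * k / p)\<close>; since \<open>p\<close> is odd, the estimate for
  \<open>2*m + 1\<close> applies.\<close>

lemma sum_inverse_norm_one_minus_add_char:
  assumes "CARD('p::prime_card) > 2"
  shows "(\<Sum>a\<in>UNIV - {0 :: 'p mod_ring}. 2 / norm (1 - add_char a))
    \<le> real CARD('p) * ln (real CARD('p))"
proof -
  define p where "p = CARD('p)"
  have "odd p" using assms prime_card[where 'a = 'p] by (simp add: p_def prime_odd_nat)
  then obtain m where m: "p = 2 * m + 1" by (rule oddE)
  have "(\<Sum>a\<in>UNIV - {0 :: 'p mod_ring}. 2 / norm (1 - add_char a))
    = (\<Sum>k=1..2*m. 1 / sin (pi * real k / real p))"
  proof (rule sum.reindex_bij_witness[of _ "\<lambda>k. of_int_mod_ring (int k)" "\<lambda>a. nat (to_int_mod_ring a)"])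
    fix a :: "'p mod_ring" assume a: "a \<in> UNIV - {0}"
    note b = to_int_mod_ring_bounds[of a] to_int_mod_ring_pos[of a]
    show "of_int_mod_ring (int (nat (to_int_mod_ring a))) = a" using b by simp
    show "nat (to_int_mod_ring a) \<in> {1..2*m}" using b a m by (auto simp: p_def)
    show "1 / sin (pi * real (nat (to_int_mod_ring a)) / real p) = 2 / norm (1 - add_char a)"
      using b by (simp add: norm_one_minus_add_char p_def)
  next
    fix k assume k: "k \<in> {1..2*m}"
    then have kp: "int k < int CARD('p)" using m by (simp add: p_def)
    then have *: "to_int_mod_ring (of_int_mod_ring (int k) :: 'p mod_ring) = int k" by simp
    then show "nat (to_int_mod_ring (of_int_mod_ring (int k) :: 'p mod_ring)) = k" by simp
    show "of_int_mod_ring (int k) \<in> UNIV - {0 :: 'p mod_ring}"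
      using * k by auto
  qed
  also have "\<dots> \<le> real p * ln (real p)"
    unfolding m by (rule sum_inverse_sin_le)
  finally show ?thesis by (simp add: p_def)
qed

text \<open>Dividing the coefficients of the steps by \<open>1 - add_char a\<close> bounds those of
  \<open>F\<close> at nonzero frequencies. Inversion at \<open>b\<close> and \<open>b'\<close> then
  gives a sum of cosecants.\<close>

lemma oscillation_upper:
  fixes F :: "'p::prime_card mod_ring \<Rightarrow> real"
  assumes p: "CARD('p) > 2"
    and D: "\<And>a. a \<noteq> 0 \<Longrightarrow>
      norm (\<Sum>c\<in>UNIV. of_real (F c - F (c - 1)) * add_char (a * c)) \<le> sqrt (real CARD('p))"
  shows "F b - F b' \<le> sqrt (real CARD('p)) * ln (real CARD('p))"
proof -
  define H where "H = (\<lambda>a. \<Sum>c\<in>UNIV. complex_of_real (F c) * add_char (a * c))"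
  have "norm (H a) \<le> sqrt (real CARD('p)) / norm (1 - add_char a)" if "a \<noteq> 0" for a
  proof -
    have "norm (1 - add_char a) * norm (H a) \<le> sqrt (real CARD('p))"
      using D[OF that] fourier_backward_difference[of "\<lambda>c. of_real (F c)" a]
      by (simp add: H_def norm_mult)
    then show ?thesis
      using norm_one_minus_add_char_pos[OF that] by (simp add: field_simps)
  qed
  note H = this
  have "real CARD('p) * (F b - F b') \<le> norm (of_nat CARD('p) * complex_of_real (F b) - of_nat CARD('p) * complex_of_real (F b'))"
  proof -
    have "of_nat CARD('p) * complex_of_real (F b) - of_nat CARD('p) * complex_of_real (F b')
      = complex_of_real (real CARD('p) * (F b - F b'))" by (simp add: algebra_simps)
    then show ?thesis by (simp only: norm_of_real)
  qed
  also have "of_nat CARD('p) * complex_of_real (F b) - of_nat CARD('p) * complex_of_real (F b')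
    = (\<Sum>a\<in>UNIV. (add_char (- (a * b)) - add_char (- (a * b'))) * H a)"
    by (simp only: fourier_inversion[of "\<lambda>c. complex_of_real (F c)"] H_def
        sum_subtractf[symmetric] left_diff_distrib)
  \<comment> \<open>Frequency 0, where the coefficient of \<open>F\<close> is not controlled, drops
    out because both characters equal 1 there.\<close>
  also have "\<dots> = (\<Sum>a\<in>UNIV - {0}. (add_char (- (a * b)) - add_char (- (a * b'))) * H a)"
    by (intro sum.mono_neutral_right) auto
  also have "norm \<dots> \<le> (\<Sum>a\<in>UNIV - {0 :: 'p mod_ring}. sqrt (real CARD('p)) * (2 / norm (1 - add_char a)))"
  proof (rule sum_norm_le)
    fix a :: "'p mod_ring" assume a: "a \<in> UNIV - {0}"
    have "norm (add_char (- (a * b)) - add_char (- (a * b'))) \<le> 2"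
      using norm_triangle_ineq4[of "add_char (- (a * b))" "add_char (- (a * b'))"] by simp
    then have "norm ((add_char (- (a * b)) - add_char (- (a * b'))) * H a)
      \<le> 2 * (sqrt (real CARD('p)) / norm (1 - add_char a))"
      unfolding norm_mult using H[of a] a by (intro mult_mono) auto
    then show "norm ((add_char (- (a * b)) - add_char (- (a * b'))) * H a)
      \<le> sqrt (real CARD('p)) * (2 / norm (1 - add_char a))" by (simp add: mult_ac)
  qed
  also have "\<dots> = sqrt (real CARD('p)) * (\<Sum>a\<in>UNIV - {0 :: 'p mod_ring}. 2 / norm (1 - add_char a))"
    by (simp only: sum_distrib_left)
  also have "\<dots> \<le> sqrt (real CARD('p)) * (real CARD('p) * ln (real CARD('p)))"
    by (intro mult_left_mono sum_inverse_norm_one_minus_add_char p) auto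
  finally have "real CARD('p) * (F b - F b') \<le> real CARD('p) * (sqrt (real CARD('p)) * ln (real CARD('p)))"
    by (simp add: mult_ac)
  then show ?thesis by (rule mult_left_le_imp_le) simp
qed

text \<open>Subtracting \<open>m\<close> leaves the steps unchanged and puts the values between 0
  and \<open>M - m\<close>, so the coefficient at frequency 1 is at most \<open>p * (M - m)\<close>
  in modulus. The factor relating it to the steps is only \<open>2 * sin (pi / p)\<close>, the
  smallest value over nonzero frequencies.\<close>

lemma oscillation_lower:
  fixes F :: "'p::prime_card mod_ring \<Rightarrow> real"
  assumes D: "norm (\<Sum>c\<in>UNIV. of_real (F c - F (c - 1)) * add_char c) \<ge> sqrt (real CARD('p))"
    and F: "\<And>c. m \<le> F c" "\<And>c. F c \<le> M"
  shows "sqrt (real CARD('p)) / (2 * pi) \<le> M - m"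
proof -
  let ?p = "real CARD('p)"
  have "(\<Sum>c\<in>UNIV. of_real (F c - F (c - 1)) * add_char c)
    = (1 - add_char (1 :: 'p mod_ring)) * (\<Sum>c\<in>UNIV. complex_of_real (F c - m) * add_char c)"
  proof -
    have "complex_of_real (F c - F (c - 1)) = complex_of_real (F c - m) - complex_of_real (F (c - 1) - m)" for c
      by simp
    then show ?thesis
      using fourier_backward_difference[of "\<lambda>c. complex_of_real (F c - m)" 1]
      by (simp only: mult_1_left)
  qed
  then have "sqrt ?p \<le> norm (1 - add_char (1 :: 'p mod_ring))
      * norm (\<Sum>c\<in>UNIV. complex_of_real (F c - m) * add_char c)"
    using D by (simp add: norm_mult)
  also have "\<dots> \<le> (2 * (pi / ?p)) * (?p * (M - m))"
  proof (rule mult_mono)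
    show "norm (1 - add_char (1 :: 'p mod_ring)) \<le> 2 * (pi / ?p)"
      using sin_x_le_x[of "pi / ?p"] by (simp add: norm_one_minus_add_char)
    have "norm (\<Sum>c\<in>UNIV. complex_of_real (F c - m) * add_char c) \<le> (\<Sum>c\<in>(UNIV :: 'p mod_ring set). M - m)"
    proof (rule sum_norm_le)
      fix c
      have "norm (complex_of_real (F c - m)) \<le> M - m"
        using F[of c] by (simp only: norm_of_real)
      then show "norm (complex_of_real (F c - m) * add_char c) \<le> M - m"
        by (simp only: norm_mult norm_add_char mult_1_right)
    qed
    then show "norm (\<Sum>c\<in>UNIV. complex_of_real (F c - m) * add_char c) \<le> ?p * (M - m)" by simp
  qed auto
  also have "\<dots> = 2 * pi * (M - m)" by simp
  finally show ?thesis by (simp add: field_simps)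
qed

section \<open>Borrows in subtraction and the projections of the region below a graph\<close>

text \<open>The right-hand side lies in \<open>{0..<p}\<close> and reduces to \<open>u - v\<close>,
  hence it is the representative.\<close>

lemma to_int_mod_ring_diff:
  fixes u v :: "'p::prime_card mod_ring"
  shows "to_int_mod_ring (u - v)
    = to_int_mod_ring u - to_int_mod_ring v + (if u < v then int CARD('p) else 0)"
proof -
  define r where "r = to_int_mod_ring u - to_int_mod_ring v + (if u < v then int CARD('p) else 0)"
  have "0 \<le> r" "r < int CARD('p)"
    using to_int_mod_ring_bounds[of u] to_int_mod_ring_bounds[of v]
    by (auto simp: r_def less_mod_ring_def)
  then have "to_int_mod_ring (of_int_mod_ring r :: 'p mod_ring) = r" by simp
  moreover have "of_int_mod_ring r = u - v"
    by (simp add: r_def flip: of_int_of_int_mod_ring)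
       (simp add: of_int_of_int_mod_ring)
  ultimately show ?thesis by (simp add: r_def)
qed

text \<open>Sum the borrows along the line; as \<open>d\<close> is nonzero, \<open>d * x + b\<close>
  runs once through the field. The line then enters the right-hand side through the first sum
  alone.\<close>

lemma card_mult_proj_below_graph:
  fixes g :: "'p::prime_card mod_ring \<Rightarrow> 'p mod_ring"
  assumes "d \<noteq> 0"
  shows "int CARD('p) * int (proj {(x, y). y < g x} d b)
    = (\<Sum>x\<in>UNIV. to_int_mod_ring (d * x + b - g x)) + (\<Sum>x\<in>UNIV. to_int_mod_ring (g x))
      - (\<Sum>x\<in>UNIV. to_int_mod_ring (x :: 'p mod_ring))"
proof -
  have bij: "(\<Sum>x\<in>UNIV. to_int_mod_ring (d * x + b)) = (\<Sum>x\<in>UNIV. to_int_mod_ring (x :: 'p mod_ring))"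
    by (rule sum.reindex_bij_witness[of _ "\<lambda>x. (x - b) / d" "\<lambda>x. d * x + b"]) (use assms in auto)
  have "(\<Sum>x\<in>UNIV. to_int_mod_ring (d * x + b - g x))
    = (\<Sum>x\<in>UNIV. to_int_mod_ring (d * x + b)) - (\<Sum>x\<in>UNIV. to_int_mod_ring (g x))
      + (\<Sum>x\<in>UNIV. if d * x + b < g x then int CARD('p) else 0)"
    by (simp add: to_int_mod_ring_diff sum.distrib sum_subtractf)
  also have "(\<Sum>x\<in>UNIV. if d * x + b < g x then int CARD('p) else 0)
    = int CARD('p) * int (proj {(x, y). y < g x} d b)"
    by (simp add: proj_def sum.If_cases)
  finally show ?thesis using bij by simp
qed

text \<open>Passing from \<open>b\<close> to \<open>b - 1\<close> lowers every representative of
  \<open>d * x + b - g x\<close> by 1, except that 0 wraps around to \<open>p - 1\<close>. The wraps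
  occur exactly where the line meets the graph.\<close>

lemma proj_below_graph_step:
  fixes g :: "'p::prime_card mod_ring \<Rightarrow> 'p mod_ring"
  assumes "d \<noteq> 0"
  shows "int (proj {(x, y). y < g x} d b) - int (proj {(x, y). y < g x} d (b - 1))
    = 1 - int (card {x. d * x + b = g x})"
proof -
  let ?P = "\<lambda>b. int (proj {(x, y). y < g x} d b)"
  have step: "to_int_mod_ring (u - 1) = to_int_mod_ring u - 1 + (if u = 0 then int CARD('p) else 0)"
    for u :: "'p mod_ring"
  proof -
    have "u < 1 \<longleftrightarrow> u = 0"
      using to_int_mod_ring_bounds(1)[of u] to_int_mod_ring_pos[of u]
      by (cases "u = 0") (auto simp: less_mod_ring_def)
    then show ?thesis by (simp add: to_int_mod_ring_diff)
  qed
  have "int CARD('p) * ?P (b - 1) = int CARD('p) * ?P b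
    - int CARD('p) + (\<Sum>x\<in>UNIV. if d * x + b - g x = 0 then int CARD('p) else 0)"
  proof -
    have "d * x + (b - 1) - g x = (d * x + b - g x) - 1" for x by simp
    then show ?thesis
      unfolding card_mult_proj_below_graph[OF assms]
      by (simp only: step sum.distrib sum_subtractf) simp
  qed
  also have "(\<Sum>x\<in>UNIV. if d * x + b - g x = 0 then int CARD('p) else 0)
    = int CARD('p) * int (card {x. d * x + b = g x})"
    by (simp add: sum.If_cases)
  finally have "int CARD('p) * (?P b - ?P (b - 1)) = int CARD('p) * (1 - int (card {x. d * x + b = g x}))"
    by (simp add: algebra_simps)
  then show ?thesis by simp
qed

text \<open>The constant 1 in each step contributes nothing at a nonzero frequency. In the root
  count, each \<open>x\<close> contributes only at \<open>c = g x - d * x\<close>.\<close>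

lemma fourier_proj_step:
  fixes g :: "'p::prime_card mod_ring \<Rightarrow> 'p mod_ring"
  assumes "d \<noteq> 0" "a \<noteq> 0"
  defines "F \<equiv> \<lambda>b. real (proj {(x, y). y < g x} d b)"
  shows "(\<Sum>c\<in>UNIV. of_real (F c - F (c - 1)) * add_char (a * c))
    = - (\<Sum>x\<in>UNIV. add_char (a * (g x - d * x)))"
proof -
  have F: "complex_of_real (F c - F (c - 1)) = 1 - (\<Sum>x\<in>UNIV. if g x - d * x = c then 1 else 0)" for c
  proof -
    have "F c - F (c - 1) = real_of_int (int (proj {(x, y). y < g x} d c) - int (proj {(x, y). y < g x} d (c - 1)))"
      by (simp add: F_def)
    also have "\<dots> = 1 - real (card {x. d * x + c = g x})"
      by (simp add: proj_below_graph_step[OF assms(1)] del: of_int_diff)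
    also have "{x. d * x + c = g x} = {x. g x - d * x = c}" by (auto simp: algebra_simps)
    finally show ?thesis by (simp add: sum.If_cases)
  qed
  have "(\<Sum>c\<in>UNIV. of_real (F c - F (c - 1)) * add_char (a * c))
    = (\<Sum>c\<in>UNIV. add_char (a * c)) - (\<Sum>c\<in>UNIV. \<Sum>x\<in>UNIV. (if g x - d * x = c then 1 else 0) * add_char (a * c))"
    by (simp only: F left_diff_distrib sum_subtractf sum_distrib_right mult_1_left)
  also have "\<dots> = - (\<Sum>x\<in>UNIV. \<Sum>c\<in>UNIV. (if g x - d * x = c then 1 else 0) * add_char (a * c))"
    by (subst sum.swap) (simp add: sum_add_char[OF assms(2)])
  also have "\<dots> = - (\<Sum>x\<in>UNIV. add_char (a * (g x - d * x)))"
    by (simp add: if_distrib[of "\<lambda>t. t * _"] cong: if_cong)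
  finally show ?thesis .
qed

lemma card_quadratic_roots_le:
  fixes a b c :: "'a::field"
  assumes "a \<noteq> 0"
  shows "card {x. a * x^2 + b * x + c = 0} \<le> 2"
proof -
  have "[:c, b, a:] \<noteq> 0" using assms by simp
  from poly_roots_degree[OF this] assms
  have "card {x. poly [:c, b, a:] x = 0} \<le> 2" by simp
  moreover have "poly [:c, b, a:] x = a * x^2 + b * x + c" for x
    by (simp add: power2_eq_square algebra_simps)
  ultimately show ?thesis by (simp only:)
qed

text \<open>This is the discrete intermediate value theorem along a walk by unit steps from a
  minimiser to a maximiser; the walk exists because 1 generates the additive group.\<close>

lemma range_eq_interval_of_small_steps:
  fixes h :: "'p::prime_card mod_ring \<Rightarrow> int"
  assumes "\<And>b. \<bar>h b - h (b - 1)\<bar> \<le> 1"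
  shows "\<exists>m M. m \<le> M \<and> range h = {m..M}"
proof -
  define m M where "m = Min (range h)" and "M = Max (range h)"
  have fin: "finite (range h)" by simp
  have m: "m \<in> range h" and M: "M \<in> range h"
    unfolding m_def M_def by (intro Min_in Max_in; simp)+
  have bd: "m \<le> h b" "h b \<le> M" for b
    unfolding m_def M_def using fin by (auto intro: Min_le Max_ge)
  from m M obtain bm bM where bm: "m = h bm" and bM: "M = h bM" by auto
  obtain n where n: "bM - bm = of_nat n" using surj_of_nat_mod_ring[of "bM - bm"] by auto
  have "k \<in> range h" if k: "m \<le> k" "k \<le> M" for k
  proof -
    have "\<exists>i\<le>n. h (bm + of_nat i) = k"
    proof (rule nat0_intermed_int_val)
      show "\<forall>i<n. \<bar>h (bm + of_nat (i + 1)) - h (bm + of_nat i)\<bar> \<le> 1"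
      proof (intro allI impI)
        fix i
        show "\<bar>h (bm + of_nat (i + 1)) - h (bm + of_nat i)\<bar> \<le> 1"
          using assms[of "bm + of_nat (i + 1)"] by (simp add: algebra_simps)
      qed
      show "h (bm + of_nat 0) \<le> k" using k bm by simp
      show "k \<le> h (bm + of_nat n)" using k bM by (simp flip: n)
    qed
    then show ?thesis by auto
  qed
  then have "range h = {m..M}" using bd by auto
  moreover have "m \<le> M" using bd order_trans by blast
  ultimately show ?thesis by blast
qed

text \<open>Translating \<open>x\<close> by \<open>s\<close> turns the linear coefficient
  \<open>d - \<beta>\<close> of \<open>d * x + b - g x\<close> into
  \<open>d - \<beta> - 2 * \<alpha> * s\<close>. The choice of \<open>s\<close> makes this
  \<open>1 - \<beta>\<close>, the coefficient for slope 1; the change of constant term is absorbed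
  into \<open>b\<close>.\<close>

lemma proj_below_quadratic_eq:
  fixes \<alpha> \<beta> \<gamma> d b :: "'p::prime_card mod_ring"
  assumes p: "CARD('p) > 2" and \<alpha>: "\<alpha> \<noteq> 0" and d: "d \<noteq> 0"
  defines "g \<equiv> \<lambda>x. \<alpha> * x^2 + \<beta> * x + \<gamma>"
  shows "proj {(x, y). y < g x} d b
    = proj {(x, y). y < g x} 1 (b - (\<beta> - (d + 1) / 2) * ((d - 1) / (2 * \<alpha>)))"
proof -
  define s where "s = (d - 1) / (2 * \<alpha>)"
  have two: "(2 :: 'p mod_ring) \<noteq> 0" by (rule two_neq_0_mod_ring[OF p])
  have s: "2 * \<alpha> * s = d - 1" using two \<alpha> by (simp add: s_def)
  define t where "t = (d + 1) / 2"
  have t: "2 * t = d + 1" using two by (simp add: t_def)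
  have "2 * t = 2 * (d - \<alpha> * s)" using s t by (simp add: algebra_simps)
  then have t': "t = d - \<alpha> * s" using two mult_left_cancel by blast
  let ?b = "b - (\<beta> - t) * s"
  have shift: "d * (x + s) + b - g (x + s) = 1 * x + ?b - g x" for x
  proof -
    have "d * (x + s) + b - g (x + s) - (1 * x + ?b - g x) = x * (d - 1 - 2 * \<alpha> * s)"
      unfolding g_def t' by (simp add: power2_eq_square algebra_simps)
    also have "\<dots> = 0" using s by simp
    finally show ?thesis by (rule eq_iff_diff_eq_0[THEN iffD2])
  qed
  have "(\<Sum>x\<in>UNIV. to_int_mod_ring (d * x + b - g x)) = (\<Sum>x\<in>UNIV. to_int_mod_ring (1 * x + ?b - g x))"
    using sum_shift_mod_ring[of "\<lambda>x. to_int_mod_ring (d * x + b - g x)" s] by (simp only: shift)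
  then have "int CARD('p) * int (proj {(x, y). y < g x} d b)
    = int CARD('p) * int (proj {(x, y). y < g x} 1 ?b)"
    by (simp only: card_mult_proj_below_graph[OF d] card_mult_proj_below_graph[OF one_neq_zero])
  then show ?thesis by (simp add: s_def t_def)
qed

theorem theorem3p1:
  fixes \<alpha> \<beta> \<gamma> :: "'p::prime_card mod_ring"
    and f :: "'p mod_ring poly"
    and S :: "('p mod_ring \<times> 'p mod_ring) set"
  assumes "CARD('p) > 2"
    and "\<alpha> \<noteq> 0"
    and "f = [:\<gamma>, \<beta>, \<alpha>:]"
    and "S = {(x, y). y < poly f x}"
  shows "(\<forall>d b. d \<noteq> 0 \<longrightarrow>
            proj S d b = proj S 1 (b - (\<beta> - (d + 1) / 2) * ((d - 1) / (2 * \<alpha>))))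
       \<and> (\<forall>d. d \<noteq> 0 \<longrightarrow>
            (\<exists>m M :: int. m \<le> M \<and> int ` range (proj S d) = {m..M}
               \<and> sqrt (real CARD('p)) / (2 * pi) \<le> real_of_int (M - m)
               \<and> real_of_int (M - m) \<le> sqrt (real CARD('p)) * ln (real CARD('p))))"
proof (intro conjI allI impI)
  define g where "g = (\<lambda>x. \<alpha> * x^2 + \<beta> * x + \<gamma>)"
  have S: "S = {(x, y). y < g x}"
    unfolding assms(3,4) g_def by (simp add: power2_eq_square algebra_simps)
  fix d :: "'p mod_ring" assume d: "d \<noteq> 0"
  show "proj S d b = proj S 1 (b - (\<beta> - (d + 1) / 2) * ((d - 1) / (2 * \<alpha>)))" for b
    unfolding S g_def by (rule proj_below_quadratic_eq[OF assms(1,2) d])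
  define h where "h = (\<lambda>b. int (proj S d b))"
  \<comment> \<open>The step is 1 minus a number of roots, which is 0, 1 or 2.\<close>
  have "\<bar>h b - h (b - 1)\<bar> \<le> 1" for b
  proof -
    have "{x. d * x + b = g x} = {x. \<alpha> * x^2 + (\<beta> - d) * x + (\<gamma> - b) = 0}"
      by (auto simp: g_def algebra_simps)
    then have "card {x. d * x + b = g x} \<le> 2"
      using card_quadratic_roots_le[OF assms(2)] by simp
    then show ?thesis
      using proj_below_graph_step[OF d, of g b] by (simp add: h_def S)
  qed
  then obtain m M where mM: "m \<le> M" "range h = {m..M}"
    using range_eq_interval_of_small_steps by blast
  define F where "F = (\<lambda>b. real (proj S d b))"
  \<comment> \<open>Equality serves both bounds: the upper one uses every nonzero frequency, the
    lower one only \<open>a = 1\<close>.\<close>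
  have D: "norm (\<Sum>c\<in>UNIV. of_real (F c - F (c - 1)) * add_char (a * c)) = sqrt (real CARD('p))"
    if a: "a \<noteq> 0" for a
  proof -
    have "a * (g x - d * x) = (a * \<alpha>) * x^2 + (a * (\<beta> - d)) * x + a * \<gamma>" for x
      by (simp add: g_def algebra_simps)
    then show ?thesis
      using norm_quadratic_gauss_sum[OF assms(1), of "a * \<alpha>" "a * (\<beta> - d)" "a * \<gamma>"] a assms(2)
      unfolding F_def S fourier_proj_step[OF d a] by simp
  qed
  have hF: "real_of_int (h b) = F b" for b by (simp add: h_def F_def)
  have bd: "real_of_int m \<le> F b" "F b \<le> real_of_int M" for b
    using mM(2) rangeI[of h b] by (auto simp flip: hF)
  \<comment> \<open>At points where the maximum and the minimum are attained, the oscillation is the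
    length of the interval.\<close>
  obtain b b' where b: "h b = M" "h b' = m"
    using mM by (metis atLeastAtMost_iff order_refl rangeE)
  have "F b - F b' \<le> sqrt (real CARD('p)) * ln (real CARD('p))"
    by (rule oscillation_upper[OF assms(1)]) (intro eq_refl D)
  then have up: "real_of_int (M - m) \<le> sqrt (real CARD('p)) * ln (real CARD('p))"
    by (simp flip: hF b)
  have "sqrt (real CARD('p)) / (2 * pi) \<le> real_of_int M - real_of_int m"
    using D[of 1] by (intro oscillation_lower[of F] bd) simp
  then have lo: "sqrt (real CARD('p)) / (2 * pi) \<le> real_of_int (M - m)" by simp
  have "int ` range (proj S d) = {m..M}"
    using mM(2) by (simp add: h_def image_image)
  then show "\<exists>m M :: int. m \<le> M \<and> int ` range (proj S d) = {m..M}
      \<and> sqrt (real CARD('p)) / (2 * pi) \<le> real_of_int (M - m)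
      \<and> real_of_int (M - m) \<le> sqrt (real CARD('p)) * ln (real CARD('p))"
    using mM(1) lo up by blast
qed

end
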